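(* Let $h\in k[x,y,z]$ be a regular trinomial over a field $k$ of characteristic $p>0$, and let $n\ge1$. Consider the set theoretic map $$\Delta_{h,n}:\frac{(\mathbb{Z}/2\lambda_h\mathbb{Z})^*}{\{1,-1\}}\longrightarrow\left\{0,\frac1{\lambda_h},\frac{2}{\lambda_h},\dots,\frac{\lambda_h-1}{\lambda_h}\right\}\times\{0,1,\dots,\phi(2\lambda_h)-1\}\;\bigcup\;\{(1,\infty)\}$$ given by $l\mapsto(\mathrm{Td}(l),\mathrm{Ds}(l))$, where $\mathrm{Ds}(l)=s\ge0$ is the smallest integer for which $\mathrm{Td}(l^stn,u)<1$ has a solution for some $u\in L_{odd}$, and $\mathrm{Td}(l):=\mathrm{Td}(l^stn,u)$. If there is no such $s$ then $\Delta_{h,n}(l)=(1,\infty)$. Then: (1) $\Delta_{h,n}$ is a well defined map. (2) $\Delta_{h,n}\equiv\Delta_{h,n+2\lambda_h}$. (3) Either $\mathrm{Ds}(l)=\infty$ or $\mathrm{Ds}(l)<$ the order of the element $l$ in the group $(\mathbb{Z}/2\lambda_h\mathbb{Z})^*$. (4) If $\Delta_{h,n}(l)=(t',s)$ for some $s<\infty$ and $s_1\ge1$ divides $s$, then $\Delta_{h,n}(l^{s/s_1})=(t',s_1)$. In particular, if $\mathrm{Im}\,\Delta_{h,n}\ne\{(1,\infty)\}$ then $(t',1)\in\mathrm{Im}\,\Delta_{h,n}$ for some $t'>0$.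
   Context: A trinomial of degree $d$ is a homogeneous irreducible polynomial $h=M_1+M_2+M_3$, where the $M_i$ are monomials of degree $d$ in $x,y,z$. It is irregular if one or more of the points $(1,0,0),(0,1,0),(0,0,1)$ has multiplicity $\ge d/2$ on the curve $h=0$, and regular otherwise. After a permutation of $x,y,z$, a regular trinomial has one of the forms Type (I): $h=x^{a_1}y^{a_2}+y^{b_1}z^{b_2}+z^{c_1}x^{c_2}$ with $a_1,b_1,c_1>d/2$; put $\alpha=a_1+b_1-d$, $\beta=a_1+c_1-d$, $\nu=b_1+c_1-d$, $\lambda=a_1b_1+a_2c_2-b_1c_2$. Type (II): $h=x^d+x^{a_1}y^{a_2}z^{a_3}+y^bz^c$ with $a_2,c>d/2$; put $\alpha=a_2$, $\beta=c$, $\nu=a_2+c-d$, $\lambda=a_2c-a_3b$. These are positive integers. Put $t=(t_1,t_2,t_3)=(\alpha/\lambda,\beta/\lambda,\nu/\lambda)$, $a=\gcd(\alpha,\beta,\nu,\lambda)$, $\lambda_h=\lambda/a$. $\phi$ is Euler's function. $L_{odd}=\{u=(u_1,u_2,u_3)\in\mathbb{Z}^3: u_1+u_2+u_3\text{ odd}\}$. For $u\in L_{odd}$ the taxicab distance is $\mathrm{Td}(l^stn,u)=\sum_{i=1}^3|l^st_in-u_i|$. For given $l,s,n$ a $u\in L_{odd}$ with $\mathrm{Td}(l^stn,u)<1$ is unique if it exists.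
   Formalization: Part (4) is false as printed when Ds(l)=0 (e.g. h=x^3+y^3+z^3, p≠3, n=3): its first claim is stated for s≥1, and its "in particular" allows the further alternative that Im Δ_{h,n}={(t',0)} for some t'. *)

theory Defs
  imports
    "HOL-Library.Poly_Mapping"
    "HOL-Library.Extended_Nat"
    "HOL-Algebra.Coset"
    "HOL-Algebra.Multiplicative_Group"
    "HOL-Number_Theory.Residues"
    "HOL-Number_Theory.Totient"
    "HOL-Computational_Algebra.Factorial_Ring"
begin

section \<open>Regular trinomials in three variables\<close>

datatype var = X | Y | Z

type_synonym monom3 = "var \<Rightarrow>\<^sub>0 nat"

text \<open>The polynomial ring \<open>k[x,y,z]\<close>: finitely supported coefficient functions on exponent
  vectors, with the convolution product of \<^theory>\<open>HOL-Library.Poly_Mapping\<close>.\<close>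
type_synonym 'k poly3 = "monom3 \<Rightarrow>\<^sub>0 'k"

definition total_degree :: "monom3 \<Rightarrow> nat" where
  "total_degree m = Poly_Mapping.lookup m X + Poly_Mapping.lookup m Y + Poly_Mapping.lookup m Z"

definition monomial :: "monom3 \<Rightarrow> 'k::field poly3" where
  "monomial m = Poly_Mapping.single m 1"

definition trinomial :: "nat \<Rightarrow> 'k::field poly3 \<Rightarrow> bool" where
  "trinomial d h \<longleftrightarrow> irreducible h \<and>
     (\<exists>m1 m2 m3. total_degree m1 = d \<and> total_degree m2 = d \<and> total_degree m3 = d \<and>
        h = monomial m1 + monomial m2 + monomial m3)"

text \<open>Substitute 1 for the variable \<open>v\<close>.\<close>
definition dehomogenize :: "var \<Rightarrow> 'k::field poly3 \<Rightarrow> 'k poly3" where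
  "dehomogenize v h =
     (\<Sum>m\<in>Poly_Mapping.keys h. Poly_Mapping.single (Poly_Mapping.update v 0 m) (Poly_Mapping.lookup h m))"

text \<open>The multiplicity, on the curve \<open>h = 0\<close>, of the coordinate point at which \<open>v\<close> is 1 and the other
  two variables vanish. In the affine chart \<open>v = 1\<close> this point is the origin, where the multiplicity is
  the least degree of a term of the dehomogenized equation. Only meaningful for homogeneous \<open>h \<noteq> 0\<close>,
  for which the minimum is over a nonempty set.\<close>
definition coord_multiplicity :: "var \<Rightarrow> 'k::field poly3 \<Rightarrow> nat" where
  "coord_multiplicity v h = Min (total_degree ` Poly_Mapping.keys (dehomogenize v h))"

definition irregular_trinomial :: "nat \<Rightarrow> 'k::field poly3 \<Rightarrow> bool" where
  "irregular_trinomial d h \<longleftrightarrow>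
     trinomial d h \<and> (\<exists>v. real (coord_multiplicity v h) \<ge> real d / 2)"

definition regular_trinomial :: "nat \<Rightarrow> 'k::field poly3 \<Rightarrow> bool" where
  "regular_trinomial d h \<longleftrightarrow> trinomial d h \<and> \<not> irregular_trinomial d h"

definition mon3 :: "var \<Rightarrow> var \<Rightarrow> var \<Rightarrow> nat \<Rightarrow> nat \<Rightarrow> nat \<Rightarrow> 'k::field poly3" where
  "mon3 x y z i j k =
     monomial (Poly_Mapping.single x i + Poly_Mapping.single y j + Poly_Mapping.single z k)"

text \<open>\<open>normal_form d h \<alpha> \<beta> \<nu> lam\<close>: for some permutation \<open>x, y, z\<close> of the variables, \<open>h\<close> is a polynomial of
  degree \<open>d\<close> of type (I) or of type (II), and \<open>\<alpha>, \<beta>, \<nu>, lam\<close> are the integers attached to this form.\<close>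
inductive normal_form :: "nat \<Rightarrow> 'k::field poly3 \<Rightarrow> int \<Rightarrow> int \<Rightarrow> int \<Rightarrow> int \<Rightarrow> bool"
  for d :: nat and h :: "'k poly3"
  where
  type_I:
    "\<lbrakk> distinct [x, y, z];
       a1 + a2 = d; b1 + b2 = d; c1 + c2 = d;
       real a1 > real d / 2; real b1 > real d / 2; real c1 > real d / 2;
       h = mon3 x y z a1 a2 0 + mon3 x y z 0 b1 b2 + mon3 x y z c2 0 c1 \<rbrakk>
     \<Longrightarrow> normal_form d h
          (int a1 + int b1 - int d)
          (int a1 + int c1 - int d)
          (int b1 + int c1 - int d)
          (int a1 * int b1 + int a2 * int c2 - int b1 * int c2)"
| type_II:
    "\<lbrakk> distinct [x, y, z];
       a1 + a2 + a3 = d; b + c = d;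
       real a2 > real d / 2; real c > real d / 2;
       h = mon3 x y z d 0 0 + mon3 x y z a1 a2 a3 + mon3 x y z 0 b c \<rbrakk>
     \<Longrightarrow> normal_form d h
          (int a2)
          (int c)
          (int a2 + int c - int d)
          (int a2 * int c - int a3 * int b)"

lemma keys_monomial3:
  "Poly_Mapping.keys (monomial m1 + monomial m2 + monomial m3 :: 'k::field poly3) \<subseteq> {m1, m2, m3}"
  using keys_add[of "monomial m1 + monomial m2 :: 'k poly3" "monomial m3"]
    keys_add[of "monomial m1 :: 'k poly3" "monomial m2"]
  by (auto simp: monomial_def)

lemma poly3_lookup_mult_0:
  fixes f g :: "'k::field poly3"
  shows "Poly_Mapping.lookup (f * g) 0 = Poly_Mapping.lookup f 0 * Poly_Mapping.lookup g 0"
proof -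
  have z: "l = 0 \<and> q = 0" if "0 = l + q" for l q :: monom3
  proof -
    have "Poly_Mapping.lookup l v = 0 \<and> Poly_Mapping.lookup q v = 0" for v
      using arg_cong[OF that, of "\<lambda>m. Poly_Mapping.lookup m v"] by (simp add: lookup_add)
    then show ?thesis by (auto intro!: poly_mapping_eqI)
  qed
  have "(\<Sum>q. Poly_Mapping.lookup g q when 0 = l + q) = (Poly_Mapping.lookup g 0 when l = 0)" for l
  proof (cases "l = 0")
    case True
    then show ?thesis by (simp add: Sum_any.expand_superset[of "{0}"])
  next
    case False
    then have "\<not> 0 = l + q" for q using z by blast
    then show ?thesis using False by simp
  qed
  then have "Poly_Mapping.lookup (f * g) 0 =
      (\<Sum>l. Poly_Mapping.lookup f l * (Poly_Mapping.lookup g 0 when l = 0))"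
    by (simp add: lookup_mult)
  also have "\<dots> = Poly_Mapping.lookup f 0 * Poly_Mapping.lookup g 0"
    by (subst Sum_any.expand_superset[of "{0}"]) auto
  finally show ?thesis .
qed

lemma poly3_not_dvd_1:
  fixes f :: "'k::field poly3"
  assumes "Poly_Mapping.lookup f 0 = 0" shows "\<not> f dvd 1"
  by (metis assms dvd_def poly3_lookup_mult_0 lookup_one_zero mult_zero_left zero_neq_one)

lemma total_degree_eq: "distinct [x,y,z] \<Longrightarrow>
   total_degree m = Poly_Mapping.lookup m x + Poly_Mapping.lookup m y + Poly_Mapping.lookup m z"
  by (cases x; cases y; cases z) (auto simp: total_degree_def)

lemma monomial_eq_mon3:
  fixes x y z :: var
  assumes "distinct [x,y,z]"
  shows "(monomial m :: 'a::field poly3) = mon3 x y z (Poly_Mapping.lookup m x) (Poly_Mapping.lookup m y) (Poly_Mapping.lookup m z)"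
proof -
  have "m = Poly_Mapping.single x (Poly_Mapping.lookup m x) + Poly_Mapping.single y (Poly_Mapping.lookup m y)
       + Poly_Mapping.single z (Poly_Mapping.lookup m z)"
  proof (rule poly_mapping_eqI)
    fix v
    have "v = x \<or> v = y \<or> v = z" using assms by (cases x; cases y; cases z; cases v) auto
    then show "Poly_Mapping.lookup m v = Poly_Mapping.lookup (Poly_Mapping.single x (Poly_Mapping.lookup m x) + Poly_Mapping.single y (Poly_Mapping.lookup m y)
       + Poly_Mapping.single z (Poly_Mapping.lookup m z)) v"
      using assms by (auto simp: lookup_add lookup_single when_def)
  qed
  then show ?thesis unfolding mon3_def by (rule arg_cong)
qed

lemma regular_trinomial_heavy_monomial:
  fixes h :: "'k::field poly3"
  assumes r: "regular_trinomial d h"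
  shows "\<exists>m\<in>Poly_Mapping.keys h. real (Poly_Mapping.lookup m v) > real d / 2"
proof -
  from r obtain m1 m2 m3 where irr: "irreducible h" and
    deg: "total_degree m1 = d" "total_degree m2 = d" "total_degree m3 = d" and
    h: "h = monomial m1 + monomial m2 + monomial m3"
    unfolding regular_trinomial_def trinomial_def by blast
  have lt: "real (coord_multiplicity v h) < real d / 2"
    using r unfolding regular_trinomial_def irregular_trinomial_def by (meson not_le)
  have "Poly_Mapping.keys h \<subseteq> {m1,m2,m3}" unfolding h by (rule keys_monomial3)
  then have degk: "total_degree m = d" if "m \<in> Poly_Mapping.keys h" for m
    using that deg by auto
  let ?u = "Poly_Mapping.update v (0::nat)"
  have td: "total_degree (?u m) + Poly_Mapping.lookup m v = total_degree m" for m
    by (cases v) (auto simp: total_degree_def lookup_update)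
  have inj: "inj_on ?u (Poly_Mapping.keys h)"
  proof (rule inj_onI)
    fix m m' assume a: "m \<in> Poly_Mapping.keys h" "m' \<in> Poly_Mapping.keys h" "?u m = ?u m'"
    have "Poly_Mapping.lookup m v = Poly_Mapping.lookup m' v" using td[of m] td[of m'] a degk by simp
    then have "Poly_Mapping.lookup m w = Poly_Mapping.lookup m' w" for w
      using arg_cong[OF a(3), of "\<lambda>m. Poly_Mapping.lookup m w"] by (auto simp: lookup_update split: if_splits)
    then show "m = m'" by (rule poly_mapping_eqI)
  qed
  have "h \<noteq> 0" using irr by auto
  then obtain m0 where m0: "m0 \<in> Poly_Mapping.keys h" by (metis keys_eq_empty ex_in_conv)
  have "Poly_Mapping.lookup (dehomogenize v h) (?u m0) =
     (\<Sum>m\<in>Poly_Mapping.keys h. if m = m0 then Poly_Mapping.lookup h m else 0)"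
    unfolding dehomogenize_def lookup_sum
    by (rule sum.cong) (use inj m0 in \<open>auto simp: lookup_single when_def inj_on_def\<close>)
  also have "\<dots> = Poly_Mapping.lookup h m0" using m0 by simp
  also have "\<dots> \<noteq> 0" using m0 by (simp add: in_keys_iff)
  finally have ne: "Poly_Mapping.keys (dehomogenize v h) \<noteq> {}" by (metis in_keys_iff empty_iff)
  then have "coord_multiplicity v h \<in> total_degree ` Poly_Mapping.keys (dehomogenize v h)"
    unfolding coord_multiplicity_def by (intro Min_in) auto
  then obtain k where k: "k \<in> Poly_Mapping.keys (dehomogenize v h)" "coord_multiplicity v h = total_degree k"
    by auto
  from k(1) have "k \<in> (\<Union>m\<in>Poly_Mapping.keys h. Poly_Mapping.keys (Poly_Mapping.single (?u m) (Poly_Mapping.lookup h m)))"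
    unfolding dehomogenize_def by (rule subsetD[OF keys_sum])
  then obtain m where m: "m \<in> Poly_Mapping.keys h"
      and "k \<in> Poly_Mapping.keys (Poly_Mapping.single (?u m) (Poly_Mapping.lookup h m))" by (rule UN_E)
  then have km: "k = ?u m" by (simp split: if_splits)
  have "real (Poly_Mapping.lookup m v) > real d / 2"
  proof -
    have "coord_multiplicity v h + Poly_Mapping.lookup m v = d"
      using td[of m] degk[OF m] k(2) km by simp
    then have "real (coord_multiplicity v h) + real (Poly_Mapping.lookup m v) = real d"
      by (metis of_nat_add)
    with lt show ?thesis by argo
  qed
  with m show ?thesis by blast
qed

lemma irreducible_not_divisible_by_var:
  fixes h :: "'k::field poly3"
  assumes irr: "irreducible h" and h: "h = monomial m1 + monomial m2 + monomial m3"
    and big: "total_degree m1 \<ge> 2" "total_degree m2 \<ge> 2" "total_degree m3 \<ge> 2"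
    and pos: "Poly_Mapping.lookup m1 v > 0" "Poly_Mapping.lookup m2 v > 0" "Poly_Mapping.lookup m3 v > 0"
  shows False
proof -
  let ?x = "Poly_Mapping.single v (1::nat)"
  let ?r = "\<lambda>m. m - ?x"
  have e: "monomial m = (monomial ?x :: 'k poly3) * monomial (?r m)" if "Poly_Mapping.lookup m v > 0" for m
  proof -
    have "m = ?x + ?r m"
      by (rule poly_mapping_eqI) (use that in \<open>auto simp: lookup_add lookup_minus lookup_single when_def\<close>)
    then show ?thesis unfolding monomial_def by (metis mult_single mult_1_left)
  qed
  have "h = monomial ?x * (monomial (?r m1) + monomial (?r m2) + monomial (?r m3))"
    using h e[OF pos(1)] e[OF pos(2)] e[OF pos(3)] by (simp add: distrib_left)
  then have "(monomial ?x :: 'k poly3) dvd 1 \<or> (monomial (?r m1) + monomial (?r m2) + monomial (?r m3) :: 'k poly3) dvd 1"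
    using irr unfolding irreducible_def by blast
  moreover have "Poly_Mapping.lookup (monomial ?x :: 'k poly3) 0 = 0"
    unfolding monomial_def by (rule lookup_single_not_eq) (metis lookup_single_eq lookup_zero zero_neq_one)
  moreover have nz: "?r m \<noteq> 0" if "total_degree m \<ge> 2" for m
  proof
    assume "?r m = 0"
    then have "Poly_Mapping.lookup (?r m) w = 0" for w by simp
    then have z: "Poly_Mapping.lookup m w - (if v = w then 1 else 0) = 0" for w
      unfolding lookup_minus lookup_single when_def .
    have le: "Poly_Mapping.lookup m w \<le> (if v = w then 1 else 0)" for w
      using z[of w] by (auto split: if_splits)
    from le[of X] le[of Y] le[of Z]
    show False using that by (cases v) (auto simp: total_degree_def)
  qed
  then have "Poly_Mapping.lookup (monomial (?r m1) + monomial (?r m2) + monomial (?r m3) :: 'k poly3) 0 = 0"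
    unfolding monomial_def using nz[OF big(1)] nz[OF big(2)] nz[OF big(3)] by (simp add: lookup_add lookup_single_not_eq)
  ultimately show False using poly3_not_dvd_1 by blast
qed

lemma normal_form_type_I:
  fixes h :: "'k::field poly3"
  assumes "distinct [x,y,z]" "total_degree A = d" "total_degree B = d" "total_degree C = d"
   "real (Poly_Mapping.lookup A x) > real d / 2" "real (Poly_Mapping.lookup B y) > real d / 2" "real (Poly_Mapping.lookup C z) > real d / 2"
   "h = monomial A + monomial B + monomial C"
   "Poly_Mapping.lookup A z = 0" "Poly_Mapping.lookup B x = 0" "Poly_Mapping.lookup C y = 0"
  shows "\<exists>\<alpha> \<beta> \<nu> lam. normal_form d h \<alpha> \<beta> \<nu> lam"
proof -
  note td = total_degree_eq[OF assms(1), of A] total_degree_eq[OF assms(1), of B] total_degree_eq[OF assms(1), of C]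
  have h: "h = mon3 x y z (Poly_Mapping.lookup A x) (Poly_Mapping.lookup A y) 0 + mon3 x y z 0 (Poly_Mapping.lookup B y) (Poly_Mapping.lookup B z) + mon3 x y z (Poly_Mapping.lookup C x) 0 (Poly_Mapping.lookup C z)"
    unfolding assms(8) monomial_eq_mon3[OF assms(1), of A] monomial_eq_mon3[OF assms(1), of B] monomial_eq_mon3[OF assms(1), of C]
    by (simp only: assms(9-11))
  have s1: "Poly_Mapping.lookup A x + Poly_Mapping.lookup A y = d"
    using assms(2-4,9-11) td by linarith
  have s2: "Poly_Mapping.lookup B y + Poly_Mapping.lookup B z = d"
    using assms(2-4,9-11) td by linarith
  have s3: "Poly_Mapping.lookup C z + Poly_Mapping.lookup C x = d"
    using assms(2-4,9-11) td by linarith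
  show ?thesis by (intro exI) (rule type_I[OF assms(1) s1 s2 s3 assms(5-7) h])
qed

lemma normal_form_type_II:
  fixes h :: "'k::field poly3"
  assumes "distinct [x,y,z]" "total_degree A = d" "total_degree B = d" "total_degree C = d"
   "real (Poly_Mapping.lookup A x) > real d / 2" "real (Poly_Mapping.lookup B y) > real d / 2" "real (Poly_Mapping.lookup C z) > real d / 2"
   "h = monomial A + monomial B + monomial C"
   "Poly_Mapping.lookup A y = 0" "Poly_Mapping.lookup A z = 0" "Poly_Mapping.lookup C x = 0"
  shows "\<exists>\<alpha> \<beta> \<nu> lam. normal_form d h \<alpha> \<beta> \<nu> lam"
proof -
  note td = total_degree_eq[OF assms(1), of A] total_degree_eq[OF assms(1), of B] total_degree_eq[OF assms(1), of C]
  have d: "Poly_Mapping.lookup A x = d"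
    using assms(2-4,9-11) td by linarith
  have h: "h = mon3 x y z d 0 0 + mon3 x y z (Poly_Mapping.lookup B x) (Poly_Mapping.lookup B y) (Poly_Mapping.lookup B z) + mon3 x y z 0 (Poly_Mapping.lookup C y) (Poly_Mapping.lookup C z)"
    unfolding assms(8) monomial_eq_mon3[OF assms(1), of A] monomial_eq_mon3[OF assms(1), of B] monomial_eq_mon3[OF assms(1), of C]
    by (simp only: assms(9-11) d)
  have s1: "Poly_Mapping.lookup B x + Poly_Mapping.lookup B y + Poly_Mapping.lookup B z = d"
    using assms(2-4,9-11) td by linarith
  have s2: "Poly_Mapping.lookup C y + Poly_Mapping.lookup C z = d"
    using assms(2-4,9-11) td by linarith
  show ?thesis by (intro exI) (rule type_II[OF assms(1) s1 s2 assms(6,7) h])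
qed

text \<open>Every regular trinomial has a normal form, so requiring one in a statement about regular trinomials
  excludes nothing.\<close>
lemma regular_trinomial_normal_form:
  fixes h :: "'k::field poly3"
  assumes r: "regular_trinomial d h"
  shows "\<exists>\<alpha> \<beta> \<nu> lam. normal_form d h \<alpha> \<beta> \<nu> lam"
proof -
  from r obtain m1 m2 m3 where irr: "irreducible h" and
    deg: "total_degree m1 = d" "total_degree m2 = d" "total_degree m3 = d" and
    h: "h = monomial m1 + monomial m2 + monomial m3"
    unfolding regular_trinomial_def trinomial_def by blast
  have keys: "Poly_Mapping.keys h \<subseteq> {m1,m2,m3}" unfolding h by (rule keys_monomial3)
  let ?L = Poly_Mapping.lookup
  obtain A where A: "A \<in> Poly_Mapping.keys h" "real (?L A X) > real d / 2" using regular_trinomial_heavy_monomial[OF r, of X] by blast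
  obtain B where B: "B \<in> Poly_Mapping.keys h" "real (?L B Y) > real d / 2" using regular_trinomial_heavy_monomial[OF r, of Y] by blast
  obtain C where C: "C \<in> Poly_Mapping.keys h" "real (?L C Z) > real d / 2" using regular_trinomial_heavy_monomial[OF r, of Z] by blast
  have in3: "A \<in> {m1,m2,m3}" "B \<in> {m1,m2,m3}" "C \<in> {m1,m2,m3}" using A(1) B(1) C(1) keys by auto
  note big = A(2) B(2) C(2)
  have dA: "total_degree A = d" "total_degree B = d" "total_degree C = d" using in3 deg by auto
  have ne: "A \<noteq> B" "A \<noteq> C" "B \<noteq> C"
    using big dA by (auto simp: total_degree_def)
  have h': "h = monomial A + monomial B + monomial C"
    using in3 ne h by (auto simp: add_ac)
  have abs: "?L A v = 0 \<or> ?L B v = 0 \<or> ?L C v = 0" for v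
  proof (rule ccontr)
    assume "\<not> ?thesis"
    then have pos: "?L A v > 0" "?L B v > 0" "?L C v > 0" by auto
    have "d \<ge> 2" using big dA pos by (cases v) (auto simp: total_degree_def)
    then show False using irreducible_not_divisible_by_var[OF irr h' _ _ _ pos] dA by simp
  qed
  have nz: "?L A X \<noteq> 0" "?L B Y \<noteq> 0" "?L C Z \<noteq> 0" using big by (auto intro!: gr0I)
  have c: "?L B X = 0 \<or> ?L C X = 0" "?L A Y = 0 \<or> ?L C Y = 0" "?L A Z = 0 \<or> ?L B Z = 0"
    using abs[of X] abs[of Y] abs[of Z] nz by auto
  have f: "h = monomial A + monomial C + monomial B" "h = monomial B + monomial A + monomial C"
    "h = monomial B + monomial C + monomial A" "h = monomial C + monomial A + monomial B"
    "h = monomial C + monomial B + monomial A"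
    using h' by (simp_all add: add_ac)
  note I1 = normal_form_type_I[of X Y Z A d B C h, OF _ dA(1,2,3) big(1,2,3) h']
    and I2 = normal_form_type_I[of X Z Y A d C B h, OF _ dA(1,3,2) big(1,3,2) f(1)]
    and A1 = normal_form_type_II[of X Y Z A d B C h, OF _ dA(1,2,3) big(1,2,3) h']
    and A2 = normal_form_type_II[of X Z Y A d C B h, OF _ dA(1,3,2) big(1,3,2) f(1)]
    and B1 = normal_form_type_II[of Y X Z B d A C h, OF _ dA(2,1,3) big(2,1,3) f(2)]
    and B2 = normal_form_type_II[of Y Z X B d C A h, OF _ dA(2,3,1) big(2,3,1) f(3)]
    and C1 = normal_form_type_II[of Z X Y C d A B h, OF _ dA(3,1,2) big(3,1,2) f(4)]
    and C2 = normal_form_type_II[of Z Y X C d B A h, OF _ dA(3,2,1) big(3,2,1) f(5)]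
  consider "?L B X = 0" "?L C Y = 0" "?L A Z = 0" | "?L C X = 0" "?L A Y = 0" "?L B Z = 0"
    | "?L A Y = 0" "?L A Z = 0" | "?L B X = 0" "?L B Z = 0" | "?L C X = 0" "?L C Y = 0"
    using c by argo
  then show ?thesis
  proof cases
    case 1 show ?thesis by (rule I1) (use 1 in simp_all)
  next
    case 2 show ?thesis by (rule I2) (use 2 in simp_all)
  next
    case 3 show ?thesis using c(1) A1 A2 3 by auto
  next
    case 4 show ?thesis using c(2) B1 B2 4 by auto
  next
    case 5 show ?thesis using c(3) C1 C2 5 by auto
  qed
qed

definition lam_h :: "int \<Rightarrow> int \<Rightarrow> int \<Rightarrow> int \<Rightarrow> int" where
  "lam_h \<alpha> \<beta> \<nu> lam = lam div gcd \<alpha> (gcd \<beta> (gcd \<nu> lam))"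

definition t_vec :: "int \<Rightarrow> int \<Rightarrow> int \<Rightarrow> int \<Rightarrow> real \<times> real \<times> real" where
  "t_vec \<alpha> \<beta> \<nu> lam = (of_int \<alpha> / of_int lam, of_int \<beta> / of_int lam, of_int \<nu> / of_int lam)"


section \<open>Taxicab distance to the odd lattice points\<close>

definition L_odd :: "(int \<times> int \<times> int) set" where
  "L_odd = {(u1, u2, u3). odd (u1 + u2 + u3)}"

definition scale3 :: "real \<Rightarrow> real \<times> real \<times> real \<Rightarrow> real \<times> real \<times> real" where
  "scale3 r = (\<lambda>(t1, t2, t3). (r * t1, r * t2, r * t3))"

definition Td :: "real \<times> real \<times> real \<Rightarrow> int \<times> int \<times> int \<Rightarrow> real" where
  "Td = (\<lambda>(w1, w2, w3) (u1, u2, u3).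
     \<bar>w1 - of_int u1\<bar> + \<bar>w2 - of_int u2\<bar> + \<bar>w3 - of_int u3\<bar>)"


section \<open>The map $\Delta$\<close>

text \<open>\<open>Delta_value t n l v\<close>: the integer \<open>l\<close> admits \<open>v\<close> as the value \<open>(Td(l), Ds(l))\<close>. This is a relation,
  since it is not built in that \<open>Td(l)\<close> does not depend on the choice of \<open>u\<close>.\<close>
inductive Delta_value ::
    "real \<times> real \<times> real \<Rightarrow> nat \<Rightarrow> int \<Rightarrow> real \<times> enat \<Rightarrow> bool"
  for t :: "real \<times> real \<times> real" and n :: nat and l :: int
  where
  finite:
    "\<lbrakk> u \<in> L_odd; Td (scale3 (of_int l ^ s * of_nat n) t) u < 1;
       \<And>s' u'. \<lbrakk> s' < s; u' \<in> L_odd \<rbrakk> \<Longrightarrow> \<not> Td (scale3 (of_int l ^ s' * of_nat n) t) u' < 1 \<rbrakk>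
     \<Longrightarrow> Delta_value t n l (Td (scale3 (of_int l ^ s * of_nat n) t) u, enat s)"
| infinite:
    "(\<And>s u. u \<in> L_odd \<Longrightarrow> \<not> Td (scale3 (of_int l ^ s * of_nat n) t) u < 1)
     \<Longrightarrow> Delta_value t n l (1, \<infinity>)"

definition unit_group :: "int \<Rightarrow> int monoid" where
  "unit_group m = units_of (residue_ring m)"

definition unit_group_pm :: "int \<Rightarrow> int set monoid" where
  "unit_group_pm m = unit_group m Mod {1 mod m, (- 1) mod m}"

text \<open>The pairs \<open>(C, v)\<close> where \<open>v\<close> is a value of some integer \<open>l\<close> representing the class \<open>C\<close>, so that
  well-definedness of \<open>\<Delta>\<close> is single-valuedness of this relation. The elements of a coset \<open>C\<close> are the
  canonical residues in \<open>{0..m - 1}\<close>, with \<open>m = 2 lam\<^sub>h\<close>.\<close>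
definition Delta_rel ::
    "int \<Rightarrow> int \<Rightarrow> int \<Rightarrow> int \<Rightarrow> nat \<Rightarrow> int set \<Rightarrow> real \<times> enat \<Rightarrow> bool" where
  "Delta_rel \<alpha> \<beta> \<nu> lam n C v \<longleftrightarrow>
     (\<exists>l. l mod (2 * lam_h \<alpha> \<beta> \<nu> lam) \<in> C \<and> Delta_value (t_vec \<alpha> \<beta> \<nu> lam) n l v)"

definition Delta ::
    "int \<Rightarrow> int \<Rightarrow> int \<Rightarrow> int \<Rightarrow> nat \<Rightarrow> int set \<Rightarrow> real \<times> enat" where
  "Delta \<alpha> \<beta> \<nu> lam n C = (THE v. Delta_rel \<alpha> \<beta> \<nu> lam n C v)"

definition Delta_codomain :: "int \<Rightarrow> (real \<times> enat) set" where
  "Delta_codomain q =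
     {of_int i / of_int q | i. 0 \<le> i \<and> i < q} \<times> {enat s | s. s < totient (nat (2 * q))}
     \<union> {(1, \<infinity>)}"

end

theory Submission
  imports Defs
begin

text \<open>Write \<open>t = (a, b, c) / q\<close> with \<open>q = lam\<^sub>h\<close>. Changing an integer \<open>m\<close> by a multiple of \<open>2 q\<close> moves
  \<open>m t\<close> by an even lattice vector, and replacing \<open>m\<close> by \<open>- m\<close> reflects it, so the distance from \<open>m t\<close> to
  the odd lattice depends only on the class of \<open>\<plusminus> m\<close> modulo \<open>2 q\<close>. Well-definedness, periodicity in
  \<open>n\<close> and the bound by the order of \<open>l\<close> follow, and the statement on powers is the identity
  \<open>(l ^ (s / s1)) ^ s' = l ^ (s s' / s1)\<close>. A value \<open>(0, 1)\<close> cannot occur: if \<open>l n t\<close> is an odd lattice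
  point for a unit \<open>l\<close> then \<open>n t\<close> is one, so that \<open>Ds(l) = 0\<close>.\<close>

section \<open>Positivity of \<open>lam\<close> and reduction of the fractions in
  \<open>t\<close>\<close>

text \<open>An exponent above half the degree leaves less than half for the others. In type (I) this
  gives \<open>c2 < a1\<close>, hence \<open>b1 * c2 < b1 * a1\<close>; in type (II) it gives
  \<open>a3 < a2\<close> and \<open>b < c\<close>.\<close>

lemma normal_form_pos:
  assumes "normal_form d h \<alpha> \<beta> \<nu> lam"
  shows "lam > 0"
  using assms
proof cases
  case (type_I x y z a1 a2 b1 b2 c1 c2)
  then have "int b1 * int c2 < int b1 * int a1"
    by (intro mult_strict_left_mono) auto
  moreover have "int a2 * int c2 \<ge> 0" by simp
  ultimately have "int b1 * int c2 < int a1 * int b1 + int a2 * int c2"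
    by (simp only: mult.commute[of "int a1"])
  then show ?thesis using type_I(4) by simp
next
  case (type_II x y z a1 a2 a3 b c)
  then have "int a3 * int b < int a2 * int c"
    by (intro mult_strict_mono) auto
  then show ?thesis using type_II(4) by simp
qed

lemma t_vec_cancel:
  assumes "g \<noteq> 0" "g dvd \<alpha>" "g dvd \<beta>" "g dvd \<nu>" "g dvd lam"
  shows "t_vec \<alpha> \<beta> \<nu> lam = t_vec (\<alpha> div g) (\<beta> div g) (\<nu> div g) (lam div g)"
  using assms by (auto simp: t_vec_def real_of_int_div)

lemma lam_h_pos:
  assumes "lam > 0"
  shows "lam_h \<alpha> \<beta> \<nu> lam > 0"
proof -
  let ?g = "gcd \<alpha> (gcd \<beta> (gcd \<nu> lam))"
  have "?g > 0" "?g dvd lam"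
    using assms by (auto intro: dvd_trans[OF gcd_dvd2] simp: order.strict_iff_order)
  then show ?thesis
    using assms unfolding lam_h_def by (simp add: pos_imp_zdiv_pos_iff zdvd_imp_le)
qed

text \<open>Cancelling the common gcd turns the denominator into \<open>lam_h\<close>, which is what
  makes \<open>2 * lam_h\<close> the modulus of the congruences below.\<close>

lemma t_vec_reduced:
  assumes "lam > 0"
  obtains a b c where "t_vec \<alpha> \<beta> \<nu> lam = t_vec a b c (lam_h \<alpha> \<beta> \<nu> lam)"
proof -
  let ?g = "gcd \<alpha> (gcd \<beta> (gcd \<nu> lam))"
  have "?g dvd \<beta>" "?g dvd \<nu>" "?g dvd lam"
    by (meson dvd_trans gcd_dvd1 gcd_dvd2)+
  moreover have "?g \<noteq> 0" using assms by auto
  ultimately show ?thesis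
    using t_vec_cancel[of ?g \<alpha> \<beta> \<nu> lam] that unfolding lam_h_def by simp
qed


section \<open>Lattice distances of integer multiples\<close>

locale rational_point =
  fixes a b c q :: int
  assumes q_pos: "q > 0"
begin

text \<open>Distances scaled by \<open>q\<close>: an odd lattice point lies at distance \<open>k / q < 1\<close> from the \<open>m\<close>-th
  multiple of \<open>(a / q, b / q, c / q)\<close>.\<close>
definition close :: "int \<Rightarrow> int \<Rightarrow> bool" where
  "close m k \<longleftrightarrow> k < q \<and> (\<exists>u1 u2 u3. odd (u1 + u2 + u3) \<and>
     k = \<bar>m * a - q * u1\<bar> + \<bar>m * b - q * u2\<bar> + \<bar>m * c - q * u3\<bar>)"

lemma Td_t_vec:
  "Td (scale3 (of_int m) (t_vec a b c q)) (u1, u2, u3) =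
     of_int (\<bar>m * a - q * u1\<bar> + \<bar>m * b - q * u2\<bar> + \<bar>m * c - q * u3\<bar>) / of_int q"
proof -
  have *: "\<bar>of_int m * (of_int x / of_int q) - of_int u\<bar> = \<bar>of_int (m * x - q * u) :: real\<bar> / of_int q" for x u
  proof -
    have "of_int m * (of_int x / of_int q) - of_int u = (of_int (m * x - q * u) / of_int q :: real)"
      using q_pos by (simp add: diff_divide_distrib)
    then show ?thesis using q_pos by (simp only: abs_divide)
  qed
  show ?thesis
    unfolding Td_def scale3_def t_vec_def prod.case * of_int_add of_int_abs add_divide_distrib ..
qed

text \<open>Bridge from real distances to integers: clearing the denominator turns
  \<open>r < 1\<close> into \<open>k < q\<close>.\<close>

lemma Td_less_1_iff:
  "(\<exists>u\<in>L_odd. Td (scale3 (of_int m) (t_vec a b c q)) u = r \<and> r < 1) \<longleftrightarrow>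
   (\<exists>k. close m k \<and> r = of_int k / of_int q)"
proof -
  have "(of_int k / of_int q :: real) < 1 \<longleftrightarrow> k < q" for k
    using q_pos by simp
  then show ?thesis
    unfolding close_def L_odd_def Bex_def split_paired_Ex mem_Collect_eq prod.case Td_t_vec by blast
qed

lemma close_nonneg: "close m k \<Longrightarrow> 0 \<le> k"
  by (auto simp: close_def)

lemma close_less: "close m k \<Longrightarrow> k < q"
  by (simp add: close_def)

text \<open>Distinct points with odd coordinate sum have taxicab distance at least 2.\<close>
lemma close_unique:
  assumes "close m k" "close m k'"
  shows "k = k'"
proof -
  obtain u1 u2 u3 where u: "odd (u1 + u2 + u3)" "k < q"
      "k = \<bar>m * a - q * u1\<bar> + \<bar>m * b - q * u2\<bar> + \<bar>m * c - q * u3\<bar>"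
    using assms(1) unfolding close_def by blast
  obtain v1 v2 v3 where v: "odd (v1 + v2 + v3)" "k' < q"
      "k' = \<bar>m * a - q * v1\<bar> + \<bar>m * b - q * v2\<bar> + \<bar>m * c - q * v3\<bar>"
    using assms(2) unfolding close_def by blast
  let ?e = "\<bar>u1 - v1\<bar> + \<bar>u2 - v2\<bar> + \<bar>u3 - v3\<bar>"
  have tri: "q * \<bar>x - y\<bar> \<le> \<bar>w - q * x\<bar> + \<bar>w - q * y\<bar>" for w x y
  proof -
    have "q * \<bar>x - y\<bar> = \<bar>(w - q * y) - (w - q * x)\<bar>"
      using q_pos by (simp add: abs_mult flip: right_diff_distrib)
    then show ?thesis by linarith
  qed
  \<comment> \<open>The triangle inequality in each coordinate, passing through the scaled multiple
    of the point.\<close>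
  have "q * ?e \<le> k + k'"
    using tri[of u1 v1 "m * a"] tri[of u2 v2 "m * b"] tri[of u3 v3 "m * c"] u(3) v(3)
    by (simp add: distrib_left)
  also have "\<dots> < q * 2" using u(2) v(2) by simp
  finally have "?e < 2" using q_pos by simp
  \<comment> \<open>Modulo 2 an absolute difference equals the sum of its two entries, and both
    coordinate sums are odd.\<close>
  moreover have "even ?e" using u(1) v(1) by simp argo
  moreover have "e = 0" if "0 \<le> e" "e < 2" "even e" for e :: int
    using that by presburger
  ultimately have "?e = 0" by (meson abs_ge_zero add_nonneg_nonneg)
  then have "u1 = v1" "u2 = v2" "u3 = v3" by linarith+
  then show ?thesis using u(3) v(3) by simp
qed

lemma close_uminusD:
  assumes "close m k"
  shows "close (- m) k"
proof -
  obtain u1 u2 u3 where "odd (u1 + u2 + u3)" "k < q"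
      "k = \<bar>m * a - q * u1\<bar> + \<bar>m * b - q * u2\<bar> + \<bar>m * c - q * u3\<bar>"
    using assms unfolding close_def by blast
  moreover have "\<bar>- m * x - q * - u\<bar> = \<bar>m * x - q * u\<bar>" for x u
    by (simp add: abs_minus_commute)
  moreover have "odd (- u1 + - u2 + - u3) = odd (u1 + u2 + u3)" by simp argo
  ultimately show ?thesis unfolding close_def by metis
qed

lemma close_uminus: "close (- m) k = close m k"
  using close_uminusD[of m] close_uminusD[of "- m"] by auto

lemma close_shift:
  assumes "close m k"
  shows "close (m + 2 * q * j) k"
proof -
  obtain u1 u2 u3 where "odd (u1 + u2 + u3)" "k < q"
      "k = \<bar>m * a - q * u1\<bar> + \<bar>m * b - q * u2\<bar> + \<bar>m * c - q * u3\<bar>"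
    using assms unfolding close_def by blast
  \<comment> \<open>The new witness is the old one translated by \<open>2 * j\<close> times the
    numerators, an even vector.\<close>
  moreover have "(m + 2 * q * j) * x - q * (u + 2 * j * x) = m * x - q * u" for x u
    by (simp add: algebra_simps)
  moreover have "odd (u1 + 2 * j * a + (u2 + 2 * j * b) + (u3 + 2 * j * c)) = odd (u1 + u2 + u3)"
    by simp
  ultimately show ?thesis unfolding close_def by metis
qed

lemma close_cong:
  assumes "[m = m'] (mod 2 * q)"
  shows "close m k = close m' k"
proof -
  obtain j where "m' = m + 2 * q * j" using assms by (metis cong_iff_lin)
  then show ?thesis using close_shift[of m k j] close_shift[of m' k "- j"] by auto
qed

text \<open>Coprimality lets \<open>l\<close> be cancelled from \<open>q dvd l * (m * x)\<close>, so
  the \<open>m\<close>-th multiple is itself a lattice point \<open>w\<close> with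
  \<open>u = l * w\<close>. The coordinate sum of \<open>u\<close> is \<open>l\<close> times that of
  \<open>w\<close>, so oddness passes to \<open>w\<close>.\<close>

lemma close_0_cancel:
  assumes "coprime l q" "close (l * m) 0"
  shows "close m 0"
proof -
  obtain u1 u2 u3 where u: "odd (u1 + u2 + u3)"
      "0 = \<bar>l * m * a - q * u1\<bar> + \<bar>l * m * b - q * u2\<bar> + \<bar>l * m * c - q * u3\<bar>"
    using assms(2) unfolding close_def by blast
  have *: "\<exists>w. m * x = q * w \<and> v = l * w" if "l * m * x = q * v" for x v
  proof -
    have "q dvd l * (m * x)" using that by (simp add: mult.assoc)
    then have "q dvd m * x"
      using assms(1) by (simp add: coprime_dvd_mult_right_iff coprime_commute)
    then obtain w where w: "m * x = q * w" by blast
    moreover have "v = l * w" using that w q_pos by (simp add: mult.assoc mult.left_commute)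
    ultimately show ?thesis by blast
  qed
  have eqs: "l * m * a = q * u1" "l * m * b = q * u2" "l * m * c = q * u3"
    using u(2) by linarith+
  obtain w1 w2 w3 where w: "m * a = q * w1" "m * b = q * w2" "m * c = q * w3"
      "u1 = l * w1" "u2 = l * w2" "u3 = l * w3"
    using *[OF eqs(1)] *[OF eqs(2)] *[OF eqs(3)] by blast
  have "odd (w1 + w2 + w3)" using u(1) w(4-6) by auto
  then show ?thesis unfolding close_def using w(1-3) q_pos
    by (intro conjI exI[of _ w1] exI[of _ w2] exI[of _ w3]) auto
qed


section \<open>Values of $\Delta$ at integers\<close>

abbreviation val :: "nat \<Rightarrow> int \<Rightarrow> real \<times> enat \<Rightarrow> bool" where
  "val \<equiv> Delta_value (t_vec a b c q)"

text \<open>Removes real distances from the relation: least exponent and distance are both read off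
  from the integer predicate \<open>close\<close>.\<close>

lemma Delta_value_iff:
  "val n l v \<longleftrightarrow>
     (\<exists>s k. close (l ^ s * int n) k \<and> (\<forall>s'<s. \<forall>k'. \<not> close (l ^ s' * int n) k') \<and>
            v = (of_int k / of_int q, enat s)) \<or>
     (\<forall>s k. \<not> close (l ^ s * int n) k) \<and> v = (1, \<infinity>)"
proof -
  define T where "T s = Td (scale3 (of_int (l ^ s * int n)) (t_vec a b c q))" for s
  have T: "Td (scale3 (of_int l ^ s * of_nat n) (t_vec a b c q)) = T s" for s
    by (simp add: T_def)
  have close_iff: "(\<exists>u\<in>L_odd. T s u = r \<and> r < 1) \<longleftrightarrow>
      (\<exists>k. close (l ^ s * int n) k \<and> r = of_int k / of_int q)" for s r
    unfolding T_def by (rule Td_less_1_iff)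
  have none_iff: "(\<forall>u\<in>L_odd. \<not> T s u < 1) \<longleftrightarrow> (\<forall>k. \<not> close (l ^ s * int n) k)" for s
    using close_iff[of s] by blast
  show ?thesis (is "_ \<longleftrightarrow> ?fin \<or> ?inf")
  proof
    assume "val n l v"
    then show "?fin \<or> ?inf"
    proof cases
      case (finite u s)
      then have "\<forall>s'<s. \<forall>k'. \<not> close (l ^ s' * int n) k'"
        unfolding T none_iff[symmetric] by blast
      moreover obtain k where "close (l ^ s * int n) k" "T s u = of_int k / of_int q"
        using finite(2,3) close_iff[of s "T s u"] unfolding T by blast
      ultimately show ?thesis using finite(1) unfolding T by blast
    next
      case infinite
      then have "\<forall>s k. \<not> close (l ^ s * int n) k"
        unfolding T none_iff[symmetric] by blast
      then show ?thesis using infinite(1) by blast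
    qed
  next
    assume "?fin \<or> ?inf"
    then show "val n l v"
    proof
      assume ?fin
      then obtain s k where k: "close (l ^ s * int n) k" "v = (of_int k / of_int q, enat s)"
          and none: "\<forall>s'<s. \<forall>k'. \<not> close (l ^ s' * int n) k'"
        by (elim exE conjE)
      from none have least: "\<forall>s'<s. \<forall>u\<in>L_odd. \<not> T s' u < 1"
        unfolding none_iff .
      obtain u where "u \<in> L_odd" "T s u < 1" "v = (T s u, enat s)"
        using close_iff[of s "of_int k / of_int q"] k by metis
      then show ?thesis
        using Delta_value.finite[of u l s n "t_vec a b c q"] least unfolding T by simp
    next
      assume ?inf
      then show ?thesis
        using Delta_value.infinite[of l n "t_vec a b c q"] unfolding T none_iff[symmetric] by blast
    qed
  qed
qed

text \<open>Reduces every invariance of the value under changes of \<open>l\<close> and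
  \<open>n\<close> to an invariance of \<open>close\<close>.\<close>

lemma Delta_value_cong:
  assumes "\<And>s k. close (l ^ s * int n) k = close (l' ^ s * int n') k"
  shows "val n l v = val n' l' v"
proof -
  define P where "P s k = close (l ^ s * int n) k" for s k
  have P': "close (l' ^ s * int n') k = P s k" for s k
    using assms by (simp add: P_def)
  show ?thesis unfolding Delta_value_iff P_def[symmetric] P' ..
qed

text \<open>The least exponent exists by well-ordering and is unique; at that exponent
  \<open>close_unique\<close> fixes the distance.\<close>

lemma Delta_value_ex1: "\<exists>!v. val n l v"
proof (cases "\<exists>s k. close (l ^ s * int n) k")
  case True
  define s where "s = (LEAST s. \<exists>k. close (l ^ s * int n) k)"
  obtain k where k: "close (l ^ s * int n) k"
    using LeastI_ex[OF True] unfolding s_def by blast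
  have "\<not> close (l ^ s' * int n) k'" if "s' < s" for s' k'
    using not_less_Least[of s'] that unfolding s_def by blast
  then have ex: "val n l (of_int k / of_int q, enat s)" unfolding Delta_value_iff using k by blast
  have "v = (of_int k / of_int q, enat s)" if "val n l v" for v
  proof -
    obtain s1 k1 where *: "close (l ^ s1 * int n) k1" "\<forall>s'<s1. \<forall>k'. \<not> close (l ^ s' * int n) k'"
        "v = (of_int k1 / of_int q, enat s1)"
      using \<open>val n l v\<close> True unfolding Delta_value_iff by blast
    have "s1 = s"
      using * k \<open>\<And>s' k'. s' < s \<Longrightarrow> \<not> close (l ^ s' * int n) k'\<close> by (meson linorder_neqE_nat)
    then show ?thesis using * k close_unique by blast
  qed
  with ex show ?thesis by blast
next
  case False
  then show ?thesis unfolding Delta_value_iff by blast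
qed

lemma Delta_value_cong_pm:
  assumes "[l' = l] (mod 2 * q) \<or> [l' = - l] (mod 2 * q)"
  shows "val n l' v = val n l v"
proof (rule Delta_value_cong)
  fix s k
  show "close (l' ^ s * int n) k = close (l ^ s * int n) k"
    using assms
  proof
    assume "[l' = l] (mod 2 * q)"
    then show ?thesis by (intro close_cong cong_mult cong_pow cong_refl)
  next
    assume "[l' = - l] (mod 2 * q)"
    then have "close (l' ^ s * int n) k = close ((- l) ^ s * int n) k"
      by (intro close_cong cong_mult cong_pow cong_refl)
    \<comment> \<open>\<open>(- l) ^ s\<close> is \<open>l ^ s\<close> up to sign, and the sign is
      absorbed by reflection.\<close>
    also have "\<dots> = close (l ^ s * int n) k"
      by (cases "even s") (simp_all add: close_uminus)
    finally show ?thesis .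
  qed
qed

lemma Delta_value_period: "val (n + nat (2 * q)) l v = val n l v"
proof (rule Delta_value_cong)
  fix s k
  have "[int (n + nat (2 * q)) = int n] (mod 2 * q)" using q_pos by (simp add: cong_def)
  then show "close (l ^ s * int (n + nat (2 * q))) k = close (l ^ s * int n) k"
    by (intro close_cong cong_mult cong_refl)
qed

text \<open>With \<open>e = s div s1\<close>, exponents \<open>s' < s1\<close> of
  \<open>l ^ e\<close> are exponents \<open>e * s' < s\<close> of \<open>l\<close>, so minimality is
  inherited.\<close>

lemma Delta_value_power:
  assumes "val n l (r, enat s)" "s \<ge> 1" "s1 \<ge> 1" "s1 dvd s"
  shows "val n (l ^ (s div s1)) (r, enat s1)"
proof -
  let ?e = "s div s1"
  obtain k where k: "close (l ^ s * int n) k" "\<forall>s'<s. \<forall>k'. \<not> close (l ^ s' * int n) k'"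
      "r = of_int k / of_int q"
    using assms(1) unfolding Delta_value_iff by auto
  have s: "?e * s1 = s" using assms(4) by simp
  \<comment> \<open>Here \<open>s \<ge> 1\<close> enters: for \<open>s = 0\<close> the factor would
    be 0.\<close>
  have "?e > 0" using assms(2) s by (metis gr0I mult_zero_left not_one_le_zero)
  then have "?e * s' < s" if "s' < s1" for s' using that s by (metis mult_less_mono2)
  then show ?thesis unfolding Delta_value_iff power_mult[symmetric] s using k s
    by (intro disjI1 exI[of _ s1] exI[of _ k]) auto
qed

text \<open>Otherwise \<open>l ^ (s - N)\<close> is congruent to \<open>l ^ s\<close>, so a smaller
  exponent already succeeds.\<close>

lemma Delta_value_finite_less_period:
  assumes "val n l (r, enat s)" "[l ^ N = 1] (mod 2 * q)" "N > 0"
  shows "s < N"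
proof (rule ccontr)
  assume "\<not> s < N"
  obtain k where k: "close (l ^ s * int n) k" "\<forall>s'<s. \<forall>k'. \<not> close (l ^ s' * int n) k'"
    using assms(1) unfolding Delta_value_iff by auto
  have "[l ^ (s - N) * l ^ N = l ^ (s - N) * 1] (mod 2 * q)"
    by (intro cong_mult cong_refl assms(2))
  then have "[l ^ s = l ^ (s - N)] (mod 2 * q)"
    using \<open>\<not> s < N\<close> by (simp flip: power_add)
  then have "close (l ^ (s - N) * int n) k"
    using k(1) close_cong[OF cong_mult[OF _ cong_refl]] by blast
  moreover have "s - N < s" using \<open>\<not> s < N\<close> assms(3) by simp
  ultimately show False using k(2) by blast
qed

lemma Delta_value_range:
  assumes "val n l (r, e)" "e \<noteq> \<infinity>"
  shows "r \<in> {of_int i / of_int q | i. 0 \<le> i \<and> i < q}"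
  using assms close_nonneg close_less unfolding Delta_value_iff by blast

lemma Delta_value_infinite: "val n l (r, \<infinity>) \<Longrightarrow> r = 1"
  unfolding Delta_value_iff by auto

text \<open>Since \<open>l ^ 0 = 1\<close>, the right side is free of \<open>l\<close>: exponent 0
  at one integer means the same value at all integers.\<close>

lemma Delta_value_0: "val n l (r, 0) \<longleftrightarrow> (\<exists>k. close (int n) k \<and> r = of_int k / of_int q)"
  unfolding Delta_value_iff by (auto simp: zero_enat_def)

text \<open>Minimality of exponent 1 says that \<open>n\<close> itself is not close; distance 0 at
  \<open>l * n\<close> would descend to \<open>n\<close>.\<close>

lemma Delta_value_1_pos:
  assumes "val n l (r, 1)" "coprime l q"
  shows "r > 0"
proof -
  obtain k where k: "close (l * int n) k" "\<And>k'. \<not> close (int n) k'" "r = of_int k / of_int q"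
    using assms(1) unfolding Delta_value_iff by (auto simp: one_enat_def)
  have "k \<noteq> 0" using close_0_cancel[OF assms(2)] k by blast
  then show ?thesis using k(3) close_nonneg[OF k(1)] q_pos by simp
qed

end


section \<open>Units modulo sign\<close>

context residues
begin

lemma unit_group_eq: "unit_group m = units_of R"
  by (simp add: unit_group_def R_m_def)

lemma comm_group_unit_group: "comm_group (unit_group m)"
  unfolding unit_group_eq by (rule units_comm_group)

lemma carrier_unit_group: "carrier (unit_group m) = {x. 0 < x \<and> x < m \<and> coprime x m}"
  unfolding unit_group_eq units_of_carrier by (rule res_units_eq)

lemma order_unit_group: "order (unit_group m) = totient (nat m)"
  by (simp add: order_def unit_group_eq units_of_carrier totient_eq)

lemma mult_unit_group: "x \<otimes>\<^bsub>unit_group m\<^esub> y = x * y mod m"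
  by (simp add: unit_group_eq units_of_mult res_mult_eq)

lemma one_unit_group: "\<one>\<^bsub>unit_group m\<^esub> = 1"
  by (simp add: unit_group_eq units_of_one res_one_eq)

lemma pow_unit_group:
  assumes "x \<in> carrier (unit_group m)"
  shows "x [^]\<^bsub>unit_group m\<^esub> (k :: nat) = x ^ k mod m"
proof -
  have "x = x mod m" using assms by (simp add: carrier_unit_group)
  then show ?thesis
    using assms pow_cong[of x k] by (simp add: unit_group_eq units_of_carrier units_of_pow)
qed

text \<open>Both elements are their own inverses, and every subgroup of a commutative group is
  normal.\<close>

lemma normal_pm: "{1 mod m, (- 1) mod m} \<lhd> unit_group m"
proof -
  interpret U: comm_group "unit_group m" by (rule comm_group_unit_group)
  let ?H = "{1 mod m, (- 1) mod m}"
  have "?H \<subseteq> carrier (unit_group m)"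
    using mod_in_res_units[OF m_gt_one, of 1] mod_in_res_units[OF m_gt_one, of "- 1"]
    by (simp add: unit_group_eq units_of_carrier)
  moreover have "x * y mod m \<in> ?H" if "x \<in> ?H" "y \<in> ?H" for x y
    using that by (auto simp: mod_simps)
  moreover have "inv\<^bsub>unit_group m\<^esub> x = x" if "x \<in> ?H" for x
    using that calculation(1) m_gt_one
    by (intro U.inv_equality) (auto simp: mult_unit_group one_unit_group mod_simps)
  ultimately have "subgroup ?H (unit_group m)"
    by (intro U.subgroupI) (auto simp: mult_unit_group)
  then show ?thesis by (rule U.subgroup_imp_normal)
qed

lemma pm_coset: "{1 mod m, (- 1) mod m} #>\<^bsub>unit_group m\<^esub> x = {x mod m, (- x) mod m}"
  by (auto simp: r_coset_def mult_unit_group mod_simps)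

lemma carrier_unit_group_pm:
  "C \<in> carrier (unit_group_pm m) \<longleftrightarrow>
     (\<exists>x\<in>carrier (unit_group m). C = {x mod m, (- x) mod m})"
  unfolding unit_group_pm_def carrier_FactGroup pm_coset by auto

lemma unit_group_pm_ex_elem:
  assumes "C \<in> carrier (unit_group_pm m)"
  shows "\<exists>x. x \<in> C"
  using assms by (auto simp: carrier_unit_group_pm)

lemma unit_group_pm_ne: "carrier (unit_group_pm m) \<noteq> {}"
proof -
  have "(1 :: int) \<in> carrier (unit_group m)" using m_gt_one by (simp add: carrier_unit_group)
  then show ?thesis using carrier_unit_group_pm by blast
qed

text \<open>Allows any member of a class to serve as its representative, because negation preserves
  coprimality and swaps the two residues.\<close>

lemma unit_group_pm_elem:
  assumes "C \<in> carrier (unit_group_pm m)" "x \<in> C"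
  shows "x \<in> carrier (unit_group m)" "C = {x mod m, (- x) mod m}"
proof -
  obtain y where y: "y \<in> carrier (unit_group m)" "C = {y mod m, (- y) mod m}"
    using assms(1) carrier_unit_group_pm by blast
  show "C = {x mod m, (- x) mod m}" using y(2) assms(2) by (auto simp: mod_simps)
  have "coprime (- y) m" using y(1) by (simp add: carrier_unit_group)
  then have "y mod m \<in> Units R" "(- y) mod m \<in> Units R"
    using y(1) by (auto simp only: carrier_unit_group mem_Collect_eq intro: mod_in_res_units[OF m_gt_one])
  then show "x \<in> carrier (unit_group m)"
    using assms(2) y(2) by (auto simp: unit_group_eq units_of_carrier)
qed

text \<open>Projection to the quotient is a homomorphism, so powers of a class can be computed on a
  representative.\<close>

lemma unit_group_pm_pow:
  assumes "C \<in> carrier (unit_group_pm m)" "x \<in> C"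
  shows "C [^]\<^bsub>unit_group_pm m\<^esub> (k :: nat) \<in> carrier (unit_group_pm m)"
    and "x ^ k mod m \<in> C [^]\<^bsub>unit_group_pm m\<^esub> k"
proof -
  interpret U: comm_group "unit_group m" by (rule comm_group_unit_group)
  interpret H: normal "{1 mod m, (- 1) mod m}" "unit_group m" by (rule normal_pm)
  interpret Q: group "unit_group_pm m" unfolding unit_group_pm_def by (rule H.factorgroup_is_group)
  show "C [^]\<^bsub>unit_group_pm m\<^esub> k \<in> carrier (unit_group_pm m)"
    using assms(1) by (rule Q.nat_pow_closed)
  have x: "x \<in> carrier (unit_group m)" "C = {1 mod m, (- 1) mod m} #>\<^bsub>unit_group m\<^esub> x"
    using unit_group_pm_elem[OF assms] unfolding pm_coset .
  have "C [^]\<^bsub>unit_group_pm m\<^esub> k = {1 mod m, (- 1) mod m} #>\<^bsub>unit_group m\<^esub> (x ^ k mod m)"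
    unfolding x(2) unit_group_pm_def using H.FactGroup_pow[OF x(1)] pow_unit_group[OF x(1)] by simp
  then show "x ^ k mod m \<in> C [^]\<^bsub>unit_group_pm m\<^esub> k" by (simp add: pm_coset)
qed

text \<open>Supplies the order as the period for \<open>Delta_value_finite_less_period\<close>, and
  its bound by the group order for the codomain.\<close>

lemma unit_group_ord:
  assumes "x \<in> carrier (unit_group m)"
  shows "group.ord (unit_group m) x > 0" "group.ord (unit_group m) x \<le> totient (nat m)"
    "[x ^ group.ord (unit_group m) x = 1] (mod m)"
proof -
  interpret U: comm_group "unit_group m" by (rule comm_group_unit_group)
  have fin: "finite (carrier (unit_group m))" by (simp add: unit_group_eq units_of_carrier)
  show "group.ord (unit_group m) x > 0" using U.ord_ge_1[OF fin assms] by simp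
  show "group.ord (unit_group m) x \<le> totient (nat m)"
    using U.ord_le_group_order[OF fin assms] by (simp add: order_unit_group)
  show "[x ^ group.ord (unit_group m) x = 1] (mod m)"
    using U.pow_ord_eq_1[OF assms] m_gt_one
    by (simp add: pow_unit_group[OF assms] one_unit_group cong_def)
qed

end

section \<open>Passage from integers to classes modulo sign\<close>

text \<open>If the \<open>n\<close>-th multiple of \<open>t\<close> is already within distance 1 of
  \<open>L_odd\<close>, exponent 0 is least for every class. This is why the clause on powers takes
  \<open>s \<ge> 1\<close> and the last clause has the alternative of a single value
  \<open>(t', 0)\<close>.\<close>

theorem theorem3p5:
  fixes h :: "'k::field poly3" and p d n :: nat and \<alpha> \<beta> \<nu> lam :: int
  defines "q \<equiv> lam_h \<alpha> \<beta> \<nu> lam"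
  defines "G \<equiv> unit_group (2 * q)"
  defines "Q \<equiv> unit_group_pm (2 * q)"
  defines "\<Delta> \<equiv> Delta \<alpha> \<beta> \<nu> lam"
  assumes char: "CHAR('k) = p" "p > 0"
    and regular: "regular_trinomial d h"
    and form: "normal_form d h \<alpha> \<beta> \<nu> lam"
    and n: "n \<ge> 1"
  shows
    "((\<forall>C\<in>carrier Q. \<exists>!v. Delta_rel \<alpha> \<beta> \<nu> lam n C v) \<and> \<Delta> n \<in> carrier Q \<rightarrow> Delta_codomain q)
     \<and> (\<forall>C\<in>carrier Q. \<Delta> n C = \<Delta> (n + nat (2 * q)) C)
     \<and> (\<forall>C\<in>carrier Q. \<forall>l\<in>C. snd (\<Delta> n C) = \<infinity> \<or> snd (\<Delta> n C) < enat (group.ord G l))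
     \<and> (\<forall>C\<in>carrier Q. \<forall>t' s s1. \<Delta> n C = (t', enat s) \<and> s \<ge> 1 \<and> s1 \<ge> 1 \<and> s1 dvd s
          \<longrightarrow> \<Delta> n (C [^]\<^bsub>Q\<^esub> (s div s1)) = (t', enat s1))
     \<and> (\<Delta> n ` carrier Q \<noteq> {(1, \<infinity>)}
          \<longrightarrow> (\<exists>t'>0. (t', 1) \<in> \<Delta> n ` carrier Q) \<or> (\<exists>t'. \<Delta> n ` carrier Q = {(t', 0)}))"
proof -
  have "lam > 0" using form by (rule normal_form_pos)
  then have q: "q > 0" unfolding q_def by (rule lam_h_pos)
  obtain a b c where t: "t_vec \<alpha> \<beta> \<nu> lam = t_vec a b c q"
    using \<open>lam > 0\<close> unfolding q_def by (rule t_vec_reduced)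
  interpret rational_point a b c q using q by unfold_locales
  interpret residues "2 * q" "residue_ring (2 * q)" using q by unfold_locales auto
  \<comment> \<open>All integers reducing into \<open>C\<close> are congruent to \<open>x\<close> or
    \<open>- x\<close>, so one representative decides the relation.\<close>
  have rel: "Delta_rel \<alpha> \<beta> \<nu> lam n' C v \<longleftrightarrow> val n' x v"
    if C: "C \<in> carrier Q" "x \<in> C" for C x n' v
  proof -
    have x: "x \<in> carrier G" "C = {x mod (2 * q), (- x) mod (2 * q)}"
      using unit_group_pm_elem C unfolding Q_def G_def by blast+
    have "x mod (2 * q) = x" using x(1) by (simp add: G_def carrier_unit_group)
    moreover have "val n' l v = val n' x v" if "l mod (2 * q) \<in> C" for l
      using that unfolding x(2) by (intro Delta_value_cong_pm) (auto simp: cong_def)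
    ultimately show ?thesis unfolding Delta_rel_def t q_def[symmetric] using C(2) by metis
  qed
  have ex1: "\<exists>!v. Delta_rel \<alpha> \<beta> \<nu> lam n' C v" if "C \<in> carrier Q" for C n'
  proof -
    obtain x where "x \<in> C" using \<open>C \<in> carrier Q\<close> unit_group_pm_ex_elem unfolding Q_def by blast
    then show ?thesis using rel[OF that] Delta_value_ex1 by simp
  qed
  have val_iff: "\<Delta> n' C = v \<longleftrightarrow> val n' x v" if "C \<in> carrier Q" "x \<in> C" for C x n' v
    using theI'[OF ex1[OF that(1), of n']] ex1[OF that(1), of n'] rel[OF that, of n']
    unfolding \<Delta>_def Delta_def by blast
  have bound: "s < group.ord G x" if "C \<in> carrier Q" "x \<in> C" "\<Delta> n C = (r, enat s)" for C x r s
  proof -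
    have "x \<in> carrier (unit_group (2 * q))" using unit_group_pm_elem that unfolding Q_def by blast
    from unit_group_ord[OF this] show ?thesis
      using Delta_value_finite_less_period val_iff that unfolding G_def by blast
  qed
  have power: "\<Delta> n (C [^]\<^bsub>Q\<^esub> (s div s1)) = (r, enat s1)"
    if "C \<in> carrier Q" "\<Delta> n C = (r, enat s)" "s \<ge> 1" "s1 \<ge> 1" "s1 dvd s" for C r s s1
  proof -
    obtain x where x: "x \<in> C" using \<open>C \<in> carrier Q\<close> unit_group_pm_ex_elem unfolding Q_def by blast
    let ?y = "x ^ (s div s1)"
    have "val n ?y (r, enat s1)" using Delta_value_power val_iff[OF that(1) x] that by blast
    \<comment> \<open>Members of classes are canonical residues, so the power has to be
      reduced.\<close>
    then have "val n (?y mod (2 * q)) (r, enat s1)"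
      using Delta_value_cong_pm[of "?y mod (2 * q)" ?y] by (simp add: cong_def)
    then show ?thesis
      using val_iff unit_group_pm_pow that(1) x unfolding Q_def by blast
  qed
  have codomain: "\<Delta> n C \<in> Delta_codomain q" if C: "C \<in> carrier Q" for C
  proof -
    obtain x where x: "x \<in> C" using C unit_group_pm_ex_elem unfolding Q_def by blast
    obtain r e where v: "\<Delta> n C = (r, e)" by fastforce
    then have val: "val n x (r, e)" using val_iff[OF C x] by simp
    show ?thesis
    proof (cases e)
      case (enat s)
      have "x \<in> carrier (unit_group (2 * q))" using unit_group_pm_elem C x unfolding Q_def by blast
      \<comment> \<open>The exponent is below the order of \<open>x\<close>, which is at most the
        order of the unit group.\<close>
      then have "s < totient (nat (2 * q))"
        using bound[OF C x] unit_group_ord(2) v enat unfolding G_def by fastforce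
      moreover have "r \<in> {of_int i / of_int q | i. 0 \<le> i \<and> i < q}"
        using Delta_value_range[OF val] enat by simp
      ultimately show ?thesis unfolding v enat Delta_codomain_def by blast
    next
      case infinity
      then show ?thesis using val v Delta_value_infinite unfolding Delta_codomain_def by blast
    qed
  qed
  have period: "\<Delta> n C = \<Delta> (n + nat (2 * q)) C" if C: "C \<in> carrier Q" for C
  proof -
    obtain x where x: "x \<in> C" using C unit_group_pm_ex_elem unfolding Q_def by blast
    show ?thesis using val_iff[OF C x] Delta_value_period by metis
  qed
  have order: "snd (\<Delta> n C) = \<infinity> \<or> snd (\<Delta> n C) < enat (group.ord G l)" if "C \<in> carrier Q" "l \<in> C" for C l
    using bound[OF that] by (cases "\<Delta> n C"; cases "snd (\<Delta> n C)") auto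
  have positive: "(\<exists>t'>0. (t', 1) \<in> \<Delta> n ` carrier Q) \<or> (\<exists>t'. \<Delta> n ` carrier Q = {(t', 0)})"
    if ne: "\<Delta> n ` carrier Q \<noteq> {(1, \<infinity>)}"
  proof -
    have "carrier Q \<noteq> {}" unfolding Q_def by (rule unit_group_pm_ne)
    obtain C where C: "C \<in> carrier Q" "\<Delta> n C \<noteq> (1, \<infinity>)"
    proof (rule ccontr)
      assume "\<not> thesis"
      then have "\<Delta> n ` carrier Q = (\<lambda>_. (1, \<infinity>)) ` carrier Q"
        using that by (intro image_cong) blast+
      then show False using ne \<open>carrier Q \<noteq> {}\<close> by (simp add: image_constant_conv)
    qed
    \<comment> \<open>The only element of the codomain with infinite exponent is
      \<open>(1, \<infinity>)\<close>.\<close>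
    then obtain r s where v: "\<Delta> n C = (r, enat s)"
      using codomain[OF C(1)] unfolding Delta_codomain_def by auto
    show ?thesis
    proof (cases "s = 0")
      case True
      \<comment> \<open>The value at exponent 0 is carried from \<open>x\<close> to \<open>y\<close>
        by \<open>Delta_value_0\<close>.\<close>
      have "\<Delta> n C' = (r, 0)" if C': "C' \<in> carrier Q" for C'
      proof -
        obtain x where x: "x \<in> C" using C unit_group_pm_ex_elem unfolding Q_def by blast
        obtain y where y: "y \<in> C'" using C' unit_group_pm_ex_elem unfolding Q_def by blast
        have "val n x (r, 0)" using v True val_iff[OF C(1) x] by (simp add: zero_enat_def)
        then have "val n y (r, 0)" unfolding Delta_value_0 .
        then show ?thesis using val_iff[OF C' y] by simp
      qed
      then have "\<Delta> n ` carrier Q = {(r, 0)}" using C(1) by force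
      then show ?thesis by blast
    next
      case False
      \<comment> \<open>The power clause with \<open>s1 = 1\<close> brings the exponent down to 1 at
        the same distance.\<close>
      let ?C = "C [^]\<^bsub>Q\<^esub> s"
      have "?C \<in> carrier Q" using unit_group_pm_ex_elem unit_group_pm_pow(1) C(1) unfolding Q_def by blast
      moreover obtain y where y: "y \<in> ?C"
        using unit_group_pm_ex_elem calculation unfolding Q_def by blast
      moreover have v1: "\<Delta> n ?C = (r, 1)"
        using power[OF C(1) v, of 1] False by (simp add: one_enat_def)
      ultimately have "val n y (r, 1)" "y \<in> carrier (unit_group (2 * q))"
        using val_iff unit_group_pm_elem(1) unfolding Q_def by blast+
      \<comment> \<open>A unit modulo \<open>2 * q\<close> is coprime to \<open>q\<close>.\<close>
      then have "r > 0" using Delta_value_1_pos by (simp add: carrier_unit_group)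
      then show ?thesis using v1 \<open>?C \<in> carrier Q\<close> by (metis imageI)
    qed
  qed
  show ?thesis
  proof (intro conjI ballI allI impI Pi_I)
    show "\<exists>!v. Delta_rel \<alpha> \<beta> \<nu> lam n C v" if "C \<in> carrier Q" for C
      using that by (rule ex1)
    show "\<Delta> n (C [^]\<^bsub>Q\<^esub> (s div s1)) = (t', enat s1)"
      if "C \<in> carrier Q" "\<Delta> n C = (t', enat s) \<and> s \<ge> 1 \<and> s1 \<ge> 1 \<and> s1 dvd s" for C t' s s1
      using that by (elim conjE) (rule power)
  qed (fact codomain period order positive)+
qed

end
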